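(* Let $(X,T_X)$ be a discrete-time Markov process on a measurable space $(X,\mathcal B(X))$ with initial state $x_0\in X$, and let $\mathrm{Goal}\subseteq X$ be a measurable set. Then the proof rule "to show that $(X,T_X)$ reaches $\mathrm{Goal}$ almost surely from $x_0$, exhibit an almost-sure reachability certificate" is sound and complete, that is: (Soundness) If there exists an almost-sure reachability certificate $(\mathrm{Inv},T,V,U,H,d,\varepsilon)$ for $(X,T_X,x_0,\mathrm{Goal})$, then $\mathbb P_{x_0}(\sigma_{\mathrm{Goal}}<\infty)=1$. (Completeness) If $\mathbb P_{x_0}(\sigma_{\mathrm{Goal}}<\infty)=1$, then there exists an almost-sure reachability certificate $(\mathrm{Inv},T,V,U,H,d,\varepsilon)$ for $(X,T_X,x_0,\mathrm{Goal})$.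
   Context: A discrete-time Markov process is a pair $(X,T_X)$ where $X$ is a set with a sigma-algebra $\mathcal B(X)$ and $T_X:X\times\mathcal B(X)\to[0,1]$ is a stochastic kernel: $T_X(x,\cdot)$ is a probability measure for each $x$, and $x\mapsto T_X(x,A)$ is measurable for each $A\in\mathcal B(X)$. No topology or continuity is assumed. $\mathbb P_x$ denotes the law on infinite trajectories $(x_0,x_1,\dots)$ of the chain started at $x$. The first hitting time is $\sigma_{\mathrm{Goal}}=\min\{k\in\mathbb N: x_k\in\mathrm{Goal}\}$ (with $\mathbb N\ni 0$), and $\sigma_{\mathrm{Goal}}=\infty$ if no such $k$ exists. An almost-sure reachability certificate for $(X,T_X,x_0,\mathrm{Goal})$ consists of: 1. a measurable invariant $\mathrm{Inv}\subseteq X$ with $\mathrm{Goal}\subseteq\mathrm{Inv}$, $x_0\in\mathrm{Inv}$, and $T_X(x,\mathrm{Inv})=1$ for all $x\in\mathrm{Inv}\setminus\mathrm{Goal}$; 2. a measurable exempt set $T$ with $\mathrm{Goal}\subseteq T\subseteq\mathrm{Inv}$; 3. measurable functions $V,U:X\to\mathbb R_{\ge 0}$ (supermartingale and variant); 4. functions $H,d,\varepsilon:\mathbb R_{\ge0}\to\mathbb R_{>0}$; such that (V1, drift criterion) $V(x)=0\Leftrightarrow x\in T$, and $\int_{\mathrm{Inv}}T_X(x,dy)\,V(y)-V(x)\le 0$ for all $x\in\mathrm{Inv}\setminus T$; (V2, variant criterion) for all $r\in\mathbb R_{\ge0}$ and $x\in\mathrm{Inv}$: $V(x)\le r\Rightarrow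 U(x)\le H(r)$; $U(x)=0\Leftrightarrow x\in\mathrm{Goal}$; and, whenever $x\in\mathrm{Inv}\setminus\mathrm{Goal}$ and $U(x)\le r$, $T_X\big(x,\{y\in\mathrm{Inv}: U(y)\le U(x)-d(r)\}\big)\ge\varepsilon(r)$. *)

theory Defs
  imports "HOL-Probability.Probability"
begin

text \<open>
  The state space \<open>X\<close> is \<open>space M\<close>, its sigma-algebra is \<open>sets M\<close> (the measure carried by \<open>M\<close> is
  irrelevant), and \<open>T\<^sub>X(x, A)\<close> is \<open>measure (K x) A\<close>.  Measurability into \<open>prob_algebra M\<close> says exactly
  that each \<open>K x\<close> with \<open>x \<in> space M\<close> is a probability measure on \<open>sets M\<close> and that
  \<open>x \<mapsto> K x A\<close> is measurable for every \<open>A \<in> sets M\<close>.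
\<close>

locale markov_process =
  fixes M :: "'a measure" and K :: "'a \<Rightarrow> 'a measure"
  assumes kernel: "K \<in> M \<rightarrow>\<^sub>M prob_algebra M"

text \<open>
  The conditional law of the state at time \<open>n\<close> given the states at times \<open>0, \<dots>, n - 1\<close>;
  the law of the chain on infinite trajectories is the Ionescu-Tulcea extension of these kernels.
\<close>

definition chain_step ::
    "'a measure \<Rightarrow> ('a \<Rightarrow> 'a measure) \<Rightarrow> 'a \<Rightarrow> nat \<Rightarrow> (nat \<Rightarrow> 'a) \<Rightarrow> 'a measure" where
  "chain_step M K x n \<omega> = (case n of 0 \<Rightarrow> return M x | Suc k \<Rightarrow> K (\<omega> k))"

definition trajectory_law ::
    "'a measure \<Rightarrow> ('a \<Rightarrow> 'a measure) \<Rightarrow> 'a \<Rightarrow> (nat \<Rightarrow> 'a) measure" where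
  "trajectory_law M K x =
     projective_family.lim UNIV (Ionescu_Tulcea.CI (chain_step M K x) (\<lambda>_. M)) (\<lambda>_. M)"

context markov_process
begin

lemma Ionescu_Tulcea_chain_step:
  assumes x: "x \<in> space M"
  shows "Ionescu_Tulcea (chain_step M K x) (\<lambda>_. M)"
proof (rule Ionescu_Tulcea.intro)
  fix i :: nat
  note [measurable] = measurable_prob_algebraD[OF kernel]
  show "chain_step M K x i \<in> Pi\<^sub>M {0..<i} (\<lambda>_. M) \<rightarrow>\<^sub>M subprob_algebra M"
  proof (cases i)
    case 0
    have "return M x \<in> space (subprob_algebra M)"
      using measurable_space[OF return_measurable x] .
    then show ?thesis
      unfolding chain_step_def 0 by simp
  next
    case (Suc k)
    then have [measurable]: "(\<lambda>\<omega>. \<omega> k) \<in> Pi\<^sub>M {0..<i} (\<lambda>_. M) \<rightarrow>\<^sub>M M"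
      by (intro measurable_component_singleton) auto
    show ?thesis
      unfolding chain_step_def Suc nat.case using Suc by measurable
  qed
next
  fix i :: nat and \<omega> assume \<omega>: "\<omega> \<in> space (Pi\<^sub>M {0..<i} (\<lambda>_. M))"
  show "prob_space (chain_step M K x i \<omega>)"
  proof (cases i)
    case 0
    then show ?thesis
      by (simp add: chain_step_def prob_space_return x)
  next
    case (Suc k)
    then have "\<omega> k \<in> space M"
      using \<omega> by (auto simp: space_PiM PiE_iff)
    from measurable_space[OF kernel this] show ?thesis
      by (simp add: chain_step_def Suc space_prob_algebra)
  qed
qed

lemma sets_trajectory_law:
  assumes "x \<in> space M"
  shows "sets (trajectory_law M K x) = sets (Pi\<^sub>M UNIV (\<lambda>_. M))"
proof -
  interpret IT: Ionescu_Tulcea "chain_step M K x" "\<lambda>_. M"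
    by (rule Ionescu_Tulcea_chain_step[OF assms])
  show ?thesis
    by (simp add: trajectory_law_def)
qed

lemma emeasure_trajectory_law:
  assumes "x \<in> space M" "A \<in> sets (Pi\<^sub>M {0..<n} (\<lambda>_. M))"
  shows "emeasure (trajectory_law M K x) (prod_emb UNIV (\<lambda>_. M) {0..<n} A) =
    emeasure (Ionescu_Tulcea.C (chain_step M K x) (\<lambda>_. M) 0 n (\<lambda>_. undefined)) A"
proof -
  interpret IT: Ionescu_Tulcea "chain_step M K x" "\<lambda>_. M"
    by (rule Ionescu_Tulcea_chain_step[OF assms(1)])
  have "IT.CI {0..<n} A = IT.C 0 n (\<lambda>_. undefined) (prod_emb {0..<n} (\<lambda>_. M) {0..<n} A)"
    using assms(2) by (intro IT.emeasure_CI) auto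
  then show ?thesis
    using IT.lim[of "{0..<n}" A] assms(2)
    by (simp add: trajectory_law_def prod_emb_id sets.sets_into_space space_PiM[symmetric])
qed

lemma prob_space_trajectory_law:
  assumes "x \<in> space M"
  shows "prob_space (trajectory_law M K x)"
proof -
  interpret IT: Ionescu_Tulcea "chain_step M K x" "\<lambda>_. M"
    by (rule Ionescu_Tulcea_chain_step[OF assms])
  have "IT.C 0 0 (\<lambda>_. undefined) (space (Pi\<^sub>M {0..<0} (\<lambda>_. M))) = 1"
    using prob_space.emeasure_space_1[OF IT.prob_space_C[of "\<lambda>_. undefined" 0 0]]
    by (simp add: IT.space_C space_PiM del: IT.C.simps)
  then have "emeasure (trajectory_law M K x)
      (prod_emb UNIV (\<lambda>_. M) {0..<0} (space (Pi\<^sub>M {0..<0} (\<lambda>_. M)))) = 1"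
    using emeasure_trajectory_law[OF assms, of "space (Pi\<^sub>M {0..<0} (\<lambda>_. M))" 0] by simp
  moreover have "prod_emb UNIV (\<lambda>_. M) {0..<0} (space (Pi\<^sub>M {0..<0} (\<lambda>_. M)))
      = space (trajectory_law M K x)"
    using sets_eq_imp_space_eq[OF sets_trajectory_law[OF assms]]
    by (auto simp: prod_emb_def space_PiM)
  ultimately show ?thesis
    by (intro prob_spaceI) simp
qed

end

definition hitting_time :: "'a set \<Rightarrow> (nat \<Rightarrow> 'a) \<Rightarrow> enat" where
  "hitting_time G \<omega> = (if \<exists>k. \<omega> k \<in> G then enat (LEAST k. \<omega> k \<in> G) else \<infinity>)"

text \<open>
  Functions on \<open>\<real>\<^sub>\<ge>\<^sub>0\<close> are functions on \<open>real\<close> of which only the values at nonnegative arguments are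
  used; likewise only the values of \<open>V\<close> and \<open>U\<close> on \<open>space M\<close> matter.
\<close>

definition invariant_set ::
    "'a measure \<Rightarrow> ('a \<Rightarrow> 'a measure) \<Rightarrow> 'a \<Rightarrow> 'a set \<Rightarrow> 'a set \<Rightarrow> bool" where
  "invariant_set M K x0 Goal Inv \<longleftrightarrow>
     Inv \<in> sets M \<and> Goal \<subseteq> Inv \<and> x0 \<in> Inv \<and> (\<forall>x\<in>Inv - Goal. measure (K x) Inv = 1)"

text \<open>
  The integral of the nonnegative function \<open>V\<close> may a priori be infinite, so it is taken in
  \<open>ennreal\<close>, and \<open>\<integral> - V x \<le> 0\<close> is written as \<open>\<integral> \<le> V x\<close>
  because subtraction on \<open>ennreal\<close> is truncated.
\<close>

definition drift_criterion ::
    "'a measure \<Rightarrow> ('a \<Rightarrow> 'a measure) \<Rightarrow> 'a set \<Rightarrow> 'a set \<Rightarrow> ('a \<Rightarrow> real) \<Rightarrow> bool" where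
  "drift_criterion M K Inv T V \<longleftrightarrow>
     (\<forall>x\<in>space M. V x = 0 \<longleftrightarrow> x \<in> T) \<and>
     (\<forall>x\<in>Inv - T. (\<integral>\<^sup>+y\<in>Inv. ennreal (V y) \<partial>K x) \<le> ennreal (V x))"

definition variant_criterion ::
    "('a \<Rightarrow> 'a measure) \<Rightarrow> 'a set \<Rightarrow> 'a set \<Rightarrow> ('a \<Rightarrow> real) \<Rightarrow> ('a \<Rightarrow> real) \<Rightarrow>
      (real \<Rightarrow> real) \<Rightarrow> (real \<Rightarrow> real) \<Rightarrow> (real \<Rightarrow> real) \<Rightarrow> bool" where
  "variant_criterion K Goal Inv V U H d \<epsilon> \<longleftrightarrow>
     (\<forall>r\<ge>0. \<forall>x\<in>Inv.
        (V x \<le> r \<longrightarrow> U x \<le> H r) \<and>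
        (U x = 0 \<longleftrightarrow> x \<in> Goal) \<and>
        (x \<notin> Goal \<and> U x \<le> r \<longrightarrow> measure (K x) {y\<in>Inv. U y \<le> U x - d r} \<ge> \<epsilon> r))"

definition reachability_certificate ::
    "'a measure \<Rightarrow> ('a \<Rightarrow> 'a measure) \<Rightarrow> 'a \<Rightarrow> 'a set \<Rightarrow> 'a set \<Rightarrow> 'a set \<Rightarrow>
      ('a \<Rightarrow> real) \<Rightarrow> ('a \<Rightarrow> real) \<Rightarrow> (real \<Rightarrow> real) \<Rightarrow> (real \<Rightarrow> real) \<Rightarrow> (real \<Rightarrow> real) \<Rightarrow> bool" where
  "reachability_certificate M K x0 Goal Inv T V U H d \<epsilon> \<longleftrightarrow>
     invariant_set M K x0 Goal Inv \<and>
     T \<in> sets M \<and> Goal \<subseteq> T \<and> T \<subseteq> Inv \<and>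
     V \<in> borel_measurable M \<and> (\<forall>x\<in>space M. 0 \<le> V x) \<and>
     U \<in> borel_measurable M \<and> (\<forall>x\<in>space M. 0 \<le> U x) \<and>
     (\<forall>r\<ge>0. 0 < H r \<and> 0 < d r \<and> 0 < \<epsilon> r) \<and>
     drift_criterion M K Inv T V \<and>
     variant_criterion K Goal Inv V U H d \<epsilon>"

end

(*
  Everything is expressed through survival probabilities s_n(x) = P_x(x_0, ..., x_{n-1} avoid Goal),
  the iterates on the constant 1 of the killed operator Q f(x) = 1[x not in Goal] * int f(y) T(x,dy).
  The goal is reached almost surely from x iff the escape probability e = inf_n s_n vanishes at x, and
  e = Q e.

  Soundness. From {U <= r} the goal is hit within a bounded number of steps with probability at least
  some p(r) > 0, so a function 0 <= f <= 1 with f <= Q f on Inv that vanishes outside {U <= r} is zero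
  there.  Let c be the supremum of e on Inv and a = c - c p(H(0)); then e <= a on T.  Since V is
  superharmonic off T, the positive part of e - (a + V/R) is such an f, with r = H(R).  Letting R tend
  to infinity gives e <= a on Inv, so c <= c - c p(H(0)) and c = 0.

  Completeness. Every s_n is superharmonic off Goal.  Choose n_k with s_{n_k}(x_0) <= 2^{-k} and put
  W = s_1 + sum_k s_{n_k}.  Then Inv = {W < infinity} is invariant, and V = W with T = Goal works:
  V(x) <= r forces s_{n_k}(x) <= 1/2 for some k bounded in terms of r, so the rank U(x), the least n
  with s_{n+1}(x) <= 1/2 + 2^{-(n+2)}, is bounded in terms of r as well.
*)

theory Submission
  imports Defs
begin

section \<open>Killed kernel, survival and escape probabilities\<close>

definition killed_op :: "('a \<Rightarrow> 'a measure) \<Rightarrow> 'a set \<Rightarrow> ('a \<Rightarrow> ennreal) \<Rightarrow> 'a \<Rightarrow> ennreal" where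
  "killed_op K G f x = indicator (- G) x * (\<integral>\<^sup>+y. f y \<partial>K x)"

text \<open>
  The index counts killing steps, so \<open>survival K G n x\<close> is the probability that the states at times
  \<open>0, \<dots>, n - 1\<close> avoid \<open>G\<close>; the state at time \<open>n\<close> is unconstrained.
\<close>

definition survival :: "('a \<Rightarrow> 'a measure) \<Rightarrow> 'a set \<Rightarrow> nat \<Rightarrow> 'a \<Rightarrow> ennreal" where
  "survival K G n = (killed_op K G ^^ n) (\<lambda>_. 1)"

definition escape :: "('a \<Rightarrow> 'a measure) \<Rightarrow> 'a set \<Rightarrow> 'a \<Rightarrow> ennreal" where
  "escape K G x = (INF n. survival K G n x)"

lemma killed_op_goal: "x \<in> G \<Longrightarrow> killed_op K G f x = 0"
  by (simp add: killed_op_def)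

lemma killed_op_off_goal: "x \<notin> G \<Longrightarrow> killed_op K G f x = (\<integral>\<^sup>+y. f y \<partial>K x)"
  by (simp add: killed_op_def)

lemma survival_0: "survival K G 0 x = 1"
  by (simp add: survival_def)

lemma survival_Suc: "survival K G (Suc n) = killed_op K G (survival K G n)"
  by (simp add: survival_def)

lemma survival_goal: "x \<in> G \<Longrightarrow> survival K G (Suc n) x = 0"
  by (simp add: survival_Suc killed_op_goal)

text \<open>The levels fall strictly from 3/4 towards 1/2, level \<open>n\<close> exceeding level
  \<open>n + 1\<close> by \<open>(1/2) ^ (n + 3)\<close>. As all of them lie above 1/2, a survival
  probability of at most 1/2 bounds the rank.\<close>

definition rank_level :: "nat \<Rightarrow> real" where
  "rank_level n = 1 / 2 + (1 / 2) ^ (n + 2)"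

text \<open>The supremum \<open>c\<close> satisfies c <= c - c p and, being finite, must vanish. The
  hypothesis is additive because subtraction on \<open>ennreal\<close> truncates.\<close>

lemma contraction_imp_zero:
  fixes f :: "'b \<Rightarrow> ennreal"
  assumes "\<And>x. x \<in> I \<Longrightarrow> f x \<le> 1" and p: "0 < p"
    and contr: "\<And>x. x \<in> I \<Longrightarrow> f x + (SUP x\<in>I. f x) * ennreal p \<le> (SUP x\<in>I. f x)"
    and "x \<in> I"
  shows "f x = 0"
proof -
  define c where "c = (SUP x\<in>I. f x)"
  have "c \<le> 1" using assms(1) unfolding c_def by (intro SUP_least)
  then have "c < \<infinity>" by (simp add: le_less_trans[OF _ ennreal_one_less_top])
  then obtain c' where c': "c = ennreal c'" "0 \<le> c'" by (cases c) auto
  have "f y \<le> ennreal (c' - c' * p)" if "y \<in> I" for y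
  proof -
    have "f y + ennreal (c' * p) \<le> ennreal c'"
      using contr[OF that] p c' unfolding c_def[symmetric] by (simp add: ennreal_mult)
    moreover from this have "f y \<noteq> \<infinity>" by (auto simp: top_unique)
    then obtain b where "f y = ennreal b" "0 \<le> b" by (cases "f y") auto
    ultimately show ?thesis using p c' by (simp flip: ennreal_plus)
  qed
  then have "c \<le> ennreal (c' - c' * p)" unfolding c_def by (rule SUP_least)
  \<comment> \<open>A negative real difference would be truncated to 0; for \<open>c' > 0\<close>
    the inequality rules this out, whence the case split.\<close>
  then have "c' * p \<le> 0" using c' p by (cases "c' = 0") (auto simp: ennreal_le_iff2)
  then have "c' = 0" using c' p by (simp add: mult_le_0_iff)
  then show ?thesis
    using SUP_upper[OF \<open>x \<in> I\<close>, of f] c' unfolding c_def by simp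
qed

context markov_process
begin

lemma measurable_kernel [measurable]: "K \<in> M \<rightarrow>\<^sub>M subprob_algebra M"
  by (rule measurable_prob_algebraD[OF kernel])

lemma prob_space_kernel: "x \<in> space M \<Longrightarrow> prob_space (K x)"
  using measurable_space[OF kernel] by (simp add: space_prob_algebra)

lemma sets_kernel: "x \<in> space M \<Longrightarrow> sets (K x) = sets M"
  using measurable_space[OF kernel] by (simp add: space_prob_algebra)

lemma space_kernel: "x \<in> space M \<Longrightarrow> space (K x) = space M"
  by (rule sets_eq_imp_space_eq[OF sets_kernel])

lemma borel_measurable_kernel:
  "x \<in> space M \<Longrightarrow> f \<in> borel_measurable M \<Longrightarrow> f \<in> borel_measurable (K x)"
  by (simp add: measurable_cong_sets[OF sets_kernel refl])

lemma emeasure_kernel_space: "x \<in> space M \<Longrightarrow> emeasure (K x) (space M) = 1"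
  using prob_space.emeasure_space_1[OF prob_space_kernel] by (simp add: space_kernel)

lemma measurable_killed_op [measurable]:
  assumes [measurable]: "f \<in> borel_measurable M" "G \<in> sets M"
  shows "killed_op K G f \<in> borel_measurable M"
proof -
  have [measurable]: "(\<lambda>x. \<integral>\<^sup>+y. f y \<partial>K x) \<in> borel_measurable M"
    by (rule measurable_compose[OF measurable_kernel nn_integral_measurable_subprob_algebra]) simp
  show ?thesis
    unfolding killed_op_def[abs_def] by measurable
qed

lemma measurable_survival [measurable]:
  "G \<in> sets M \<Longrightarrow> survival K G n \<in> borel_measurable M"
proof (induction n)
  case 0
  then show ?case by (simp add: survival_def)
next
  case (Suc n)
  then show ?case by (simp add: survival_Suc)
qed

lemma measurable_escape [measurable]:
  "G \<in> sets M \<Longrightarrow> escape K G \<in> borel_measurable M"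
  unfolding escape_def[abs_def] by measurable

lemma survival_Suc_le:
  "x \<in> space M \<Longrightarrow> survival K G (Suc n) x \<le> survival K G n x"
proof (induction n arbitrary: x)
  case 0
  then show ?case
    by (auto simp: survival_Suc survival_0 killed_op_def space_kernel emeasure_kernel_space split: split_indicator)
next
  case (Suc n)
  then have "(\<integral>\<^sup>+y. survival K G (Suc n) y \<partial>K x) \<le> (\<integral>\<^sup>+y. survival K G n y \<partial>K x)"
    by (intro nn_integral_mono) (simp add: space_kernel)
  then show ?case
    unfolding survival_Suc[of K G "Suc n"] survival_Suc[of K G n]
    by (simp add: killed_op_def survival_Suc mult_left_mono)
qed

lemma decseq_survival: "x \<in> space M \<Longrightarrow> decseq (\<lambda>n. survival K G n x)"
  by (intro decseq_SucI survival_Suc_le)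

lemma survival_le_1: "x \<in> space M \<Longrightarrow> survival K G n x \<le> 1"
  using decseqD[OF decseq_survival, of x 0 n G] by (simp add: survival_0)

lemma escape_le_1: "x \<in> space M \<Longrightarrow> escape K G x \<le> 1"
  unfolding escape_def by (rule INF_lower2[of 0]) (simp_all add: survival_0)

text \<open>Monotone convergence from above, started at the integrable constant 1, exchanges infimum
  and integral; shifting the index does not change the infimum of a decreasing sequence. On
  \<open>G\<close> both sides vanish.\<close>

lemma killed_op_escape:
  assumes "x \<in> space M" "G \<in> sets M"
  shows "killed_op K G (escape K G) x = escape K G x"
proof (cases "x \<in> G")
  case True
  have "escape K G x \<le> survival K G (Suc 0) x"
    unfolding escape_def by (rule INF_lower) simp
  with True show ?thesis by (simp add: killed_op_goal survival_goal)
next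
  case False
  have "(\<integral>\<^sup>+y. escape K G y \<partial>K x) = (INF n. \<integral>\<^sup>+y. survival K G n y \<partial>K x)"
    unfolding escape_def
    by (intro nn_integral_monotone_convergence_INF_AE'[where f = "survival K G"] AE_I2)
       (use assms in \<open>auto simp: space_kernel survival_0 emeasure_kernel_space
          intro!: survival_Suc_le borel_measurable_kernel\<close>)
  also have "\<dots> = (INF n. survival K G (Suc n) x)"
    using False by (simp add: survival_Suc killed_op_off_goal)
  also have "\<dots> = escape K G x"
    unfolding escape_def proof (rule antisym)
    show "(INF n. survival K G (Suc n) x) \<le> (INF n. survival K G n x)"
      using survival_Suc_le[OF assms(1)] by (intro INF_mono) blast
    show "(INF n. survival K G n x) \<le> (INF n. survival K G (Suc n) x)"
      by (intro INF_mono) blast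
  qed
  finally show ?thesis using False by (simp add: killed_op_off_goal)
qed

subsection \<open>Trajectories avoiding the goal\<close>

text \<open>Integrating out the last coordinate replaces \<open>f\<close> by
  \<open>killed_op K G f\<close> at the preceding one, so the induction runs over all
  \<open>f\<close>. \<open>C 0 (Suc n)\<close> carries the coordinates 0 to \<open>n\<close>, the
  first drawn from \<open>return M x\<close>.\<close>

lemma nn_integral_chain_avoid:
  assumes x: "x \<in> space M" and G [measurable]: "G \<in> sets M" and f: "f \<in> borel_measurable M"
  shows "(\<integral>\<^sup>+\<omega>. indicator {\<omega>. \<forall>i<n. \<omega> i \<notin> G} \<omega> * f (\<omega> n)
    \<partial>Ionescu_Tulcea.C (chain_step M K x) (\<lambda>_. M) 0 (Suc n) (\<lambda>_. undefined)) =
    (killed_op K G ^^ n) f x"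
  using f
proof (induction n arbitrary: f)
  interpret IT: Ionescu_Tulcea "chain_step M K x" "\<lambda>_. M"
    by (rule Ionescu_Tulcea_chain_step[OF x])
  have u: "(\<lambda>_. undefined) \<in> space (Pi\<^sub>M {0::nat..<0} (\<lambda>_. M))"
    by (simp add: space_PiM)
  \<comment> \<open>The chain measure is a \<open>bind\<close> with \<open>eP n\<close>, which
    appends coordinate \<open>n\<close> drawn from \<open>chain_step\<close>; this turns the
    integral into an iterated one.\<close>
  have step: "(\<integral>\<^sup>+\<omega>. g \<omega> \<partial>IT.C 0 (Suc n) (\<lambda>_. undefined)) =
      (\<integral>\<^sup>+\<omega>. (\<integral>\<^sup>+y. g (fun_upd \<omega> n y) \<partial>chain_step M K x n \<omega>) \<partial>IT.C 0 n (\<lambda>_. undefined))"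
    if g: "g \<in> borel_measurable (Pi\<^sub>M {0..<Suc n} (\<lambda>_. M))" for g n
  proof -
    have "(\<integral>\<^sup>+\<omega>. g \<omega> \<partial>IT.C 0 (Suc n) (\<lambda>_. undefined)) =
        (\<integral>\<^sup>+\<omega>. (\<integral>\<^sup>+\<omega>'. g \<omega>' \<partial>IT.eP n \<omega>) \<partial>IT.C 0 n (\<lambda>_. undefined))"
      unfolding IT.C.simps using g IT.measurable_eP[of n]
      by (subst nn_integral_bind[where B = "Pi\<^sub>M {0..<Suc n} (\<lambda>_. M)"])
         (simp_all add: measurable_cong_sets[OF IT.sets_C[OF u] refl])
    also have "\<dots> = (\<integral>\<^sup>+\<omega>. (\<integral>\<^sup>+y. g (fun_upd \<omega> n y) \<partial>chain_step M K x n \<omega>) \<partial>IT.C 0 n (\<lambda>_. undefined))"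
      using g by (intro nn_integral_cong) (simp add: IT.space_C[OF u] IT.nn_integral_eP)
    finally show ?thesis .
  qed
  have meas: "(\<lambda>\<omega>. indicator {\<omega>. \<forall>i<n. \<omega> i \<notin> G} \<omega> * h (\<omega> n)) \<in>
      borel_measurable (Pi\<^sub>M {0..<Suc n} (\<lambda>_. M))"
    if [measurable]: "h \<in> borel_measurable M" for n and h :: "'a \<Rightarrow> ennreal"
  proof -
    have [measurable]: "(\<lambda>\<omega>. \<omega> i) \<in> Pi\<^sub>M {0..<Suc n} (\<lambda>_. M) \<rightarrow>\<^sub>M M" if "i \<le> n" for i
      using that by (intro measurable_component_singleton) auto
    \<comment> \<open>The indicator is rewritten as a finite product of coordinate indicators, whose
      measurability is immediate.\<close>
    have "(\<lambda>\<omega>. (\<Prod>i<n. indicator (- G) (\<omega> i)) * h (\<omega> n)) \<in>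
      borel_measurable (Pi\<^sub>M {0..<Suc n} (\<lambda>_. M))"
      by (intro borel_measurable_times_ennreal borel_measurable_prod_ennreal) auto
    also have "(\<lambda>\<omega>. (\<Prod>i<n. indicator (- G) (\<omega> i)) * h (\<omega> n)) =
      (\<lambda>\<omega>. indicator {\<omega>. \<forall>i<n. \<omega> i \<notin> G} \<omega> * h (\<omega> n))"
      by (auto simp: fun_eq_iff split: split_indicator)
    finally show ?thesis .
  qed
  {
    case 0
    then show ?case
      using meas[OF 0, of 0]
      by (subst step) (simp_all add: u chain_step_def nn_integral_return x)
  next
    case (Suc n)
    have "(\<integral>\<^sup>+\<omega>. indicator {\<omega>. \<forall>i<Suc n. \<omega> i \<notin> G} \<omega> * f (\<omega> (Suc n)) \<partial>IT.C 0 (Suc (Suc n)) (\<lambda>_. undefined)) =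
      (\<integral>\<^sup>+\<omega>. (\<integral>\<^sup>+y. indicator {\<omega>. \<forall>i<Suc n. \<omega> i \<notin> G} \<omega> * f y \<partial>K (\<omega> n)) \<partial>IT.C 0 (Suc n) (\<lambda>_. undefined))"
    proof -
      \<comment> \<open>Coordinate \<open>Suc n\<close> is not tested, so drawing it leaves the
        indicator unchanged.\<close>
      have "indicator {\<omega>. \<forall>i<Suc n. \<omega> i \<notin> G} (fun_upd \<omega> (Suc n) y) =
          (indicator {\<omega>. \<forall>i<Suc n. \<omega> i \<notin> G} \<omega> :: ennreal)" for \<omega> y
        by (auto simp: indicator_def)
      then show ?thesis
        unfolding step[OF meas[OF Suc.prems]] by (simp only: chain_step_def fun_upd_same nat.case)
    qed
    also have "\<dots> = (\<integral>\<^sup>+\<omega>. indicator {\<omega>. \<forall>i<n. \<omega> i \<notin> G} \<omega> * killed_op K G f (\<omega> n) \<partial>IT.C 0 (Suc n) (\<lambda>_. undefined))"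
    proof (intro nn_integral_cong)
      fix \<omega> assume "\<omega> \<in> space (IT.C 0 (Suc n) (\<lambda>_. undefined))"
      then have "\<omega> n \<in> space M"
        by (auto simp: IT.space_C[OF u] space_PiM PiE_iff simp del: IT.C.simps)
      \<comment> \<open>The conditions before time \<open>n\<close> leave the integral as a
        constant; the one at time \<open>n\<close> becomes the killing factor.\<close>
      then show "(\<integral>\<^sup>+y. indicator {\<omega>. \<forall>i<Suc n. \<omega> i \<notin> G} \<omega> * f y \<partial>K (\<omega> n)) =
          indicator {\<omega>. \<forall>i<n. \<omega> i \<notin> G} \<omega> * killed_op K G f (\<omega> n)"
        using Suc.prems
        by (subst nn_integral_cmult)
           (auto simp: killed_op_def less_Suc_eq indicator_def borel_measurable_kernel)
    qed
    also have "\<dots> = (killed_op K G ^^ n) (killed_op K G f) x"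
      using Suc.prems by (intro Suc.IH) simp
    finally show ?case
      by (simp only: funpow_swap1 funpow.simps o_apply)
  }
qed

lemma emeasure_avoid_upto:
  assumes x: "x \<in> space M" and G: "G \<in> sets M"
  shows "emeasure (trajectory_law M K x) {\<omega> \<in> space (trajectory_law M K x). \<forall>i<n. \<omega> i \<notin> G} =
    survival K G n x"
proof -
  interpret IT: Ionescu_Tulcea "chain_step M K x" "\<lambda>_. M"
    by (rule Ionescu_Tulcea_chain_step[OF x])
  let ?C = "IT.C 0 (Suc n) (\<lambda>_. undefined)"
  have u: "(\<lambda>_. undefined) \<in> space (Pi\<^sub>M {0::nat..<0} (\<lambda>_. M))"
    by (simp add: space_PiM)
  \<comment> \<open>\<open>A\<close> lives on the coordinates 0 to \<open>n\<close>, one more than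
    it tests, to match \<open>nn_integral_chain_avoid\<close> with \<open>f = 1\<close>.\<close>
  define A where "A = {\<omega> \<in> space (Pi\<^sub>M {0..<Suc n} (\<lambda>_. M)). \<forall>i<n. \<omega> i \<notin> G}"
  have A: "A \<in> sets (Pi\<^sub>M {0..<Suc n} (\<lambda>_. M))"
  proof -
    have [measurable]: "(\<lambda>\<omega>. \<omega> i) \<in> Pi\<^sub>M {0..<Suc n} (\<lambda>_. M) \<rightarrow>\<^sub>M M" if "i \<le> n" for i
      using that by (intro measurable_component_singleton) auto
    have "A = {\<omega> \<in> space (Pi\<^sub>M {0..<Suc n} (\<lambda>_. M)). \<forall>i\<in>{..<n}. \<omega> i \<in> space M - G}"
      by (auto simp: A_def space_PiM PiE_iff)
    also have "\<dots> \<in> sets (Pi\<^sub>M {0..<Suc n} (\<lambda>_. M))"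
      using G by (intro sets.sets_Collect_finite_All) auto
    finally show ?thesis .
  qed
  have "{\<omega> \<in> space (trajectory_law M K x). \<forall>i<n. \<omega> i \<notin> G} = prod_emb UNIV (\<lambda>_. M) {0..<Suc n} A"
    using sets_eq_imp_space_eq[OF sets_trajectory_law[OF x]]
    by (auto simp: prod_emb_def A_def space_PiM PiE_iff)
  then have "emeasure (trajectory_law M K x) {\<omega> \<in> space (trajectory_law M K x). \<forall>i<n. \<omega> i \<notin> G} =
      emeasure ?C A"
    using emeasure_trajectory_law[OF x A] by simp
  also have "\<dots> = (\<integral>\<^sup>+\<omega>. indicator A \<omega> \<partial>?C)"
    using A IT.sets_C[OF u, of "Suc n"] by (simp del: IT.C.simps)
  also have "\<dots> = (\<integral>\<^sup>+\<omega>. indicator {\<omega>. \<forall>i<n. \<omega> i \<notin> G} \<omega> * 1 \<partial>?C)"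
    by (intro nn_integral_cong)
       (auto simp: IT.space_C[OF u] A_def simp del: IT.C.simps split: split_indicator)
  also have "\<dots> = survival K G n x"
    using nn_integral_chain_avoid[OF x G, of "\<lambda>_. 1" n] by (simp add: survival_def del: IT.C.simps)
  finally show ?thesis .
qed

lemma emeasure_avoid:
  assumes x: "x \<in> space M" and G: "G \<in> sets M"
  shows "emeasure (trajectory_law M K x) {\<omega> \<in> space (trajectory_law M K x). \<forall>i. \<omega> i \<notin> G} =
    escape K G x"
proof -
  let ?P = "trajectory_law M K x"
  interpret prob_space ?P by (rule prob_space_trajectory_law[OF x])
  have [measurable]: "(\<lambda>\<omega>. \<omega> i) \<in> ?P \<rightarrow>\<^sub>M M" for i
    using measurable_component_singleton[of i UNIV "\<lambda>_. M"]
    by (simp add: measurable_cong_sets[OF sets_trajectory_law[OF x] refl])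
  note [measurable] = G
  have "(INF n. emeasure ?P {\<omega> \<in> space ?P. \<forall>i<n. \<omega> i \<notin> G}) =
      emeasure ?P (\<Inter>n. {\<omega> \<in> space ?P. \<forall>i<n. \<omega> i \<notin> G})"
    by (intro INF_emeasure_decseq) (auto simp: decseq_def)
  also have "(\<Inter>n. {\<omega> \<in> space ?P. \<forall>i<n. \<omega> i \<notin> G}) = {\<omega> \<in> space ?P. \<forall>i. \<omega> i \<notin> G}"
    by auto
  finally show ?thesis
    by (simp add: emeasure_avoid_upto[OF assms] escape_def)
qed

text \<open>This removes trajectories from the problem: both directions of the theorem become
  statements about \<open>escape\<close>.\<close>

lemma almost_surely_hits_iff:
  assumes x: "x \<in> space M" and G: "G \<in> sets M"
  shows "\<P>(\<omega> in trajectory_law M K x. hitting_time G \<omega> < \<infinity>) = 1 \<longleftrightarrow> escape K G x = 0"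
proof -
  let ?P = "trajectory_law M K x"
  interpret prob_space ?P by (rule prob_space_trajectory_law[OF x])
  have [measurable]: "(\<lambda>\<omega>. \<omega> i) \<in> ?P \<rightarrow>\<^sub>M M" for i
    using measurable_component_singleton[of i UNIV "\<lambda>_. M"]
    by (simp add: measurable_cong_sets[OF sets_trajectory_law[OF x] refl])
  note [measurable] = G
  have "{\<omega> \<in> space ?P. hitting_time G \<omega> < \<infinity>} = space ?P - {\<omega> \<in> space ?P. \<forall>i. \<omega> i \<notin> G}"
    by (auto simp: hitting_time_def)
  then have "\<P>(\<omega> in ?P. hitting_time G \<omega> < \<infinity>) = 1 - \<P>(\<omega> in ?P. \<forall>i. \<omega> i \<notin> G)"
    by (simp add: prob_compl)
  moreover have "escape K G x = ennreal \<P>(\<omega> in ?P. \<forall>i. \<omega> i \<notin> G)"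
    using emeasure_avoid[OF assms] by (simp add: emeasure_eq_measure)
  ultimately show ?thesis
    by (auto simp: ennreal_eq_0_iff measure_le_0_iff)
qed

subsection \<open>Soundness\<close>

lemma AE_invariant:
  assumes "invariant_set M K x0 G I" "x \<in> I" "x \<notin> G"
  shows "AE y in K x. y \<in> I"
proof -
  have I: "I \<in> sets M" and m: "measure (K x) I = 1"
    using assms by (auto simp: invariant_set_def)
  then have "x \<in> space M"
    using assms(2) sets.sets_into_space by blast
  then show ?thesis
    using I m prob_space.prob_eq_1[OF prob_space_kernel, of x I] by (simp add: sets_kernel)
qed

text \<open>With Q the killed operator, iterating f <= Q f gives f <= Q^n f <= c Q^n 1. Inequalities
  on \<open>I\<close> suffice, since from \<open>I - G\<close> the chain stays in \<open>I\<close>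
  almost surely and on \<open>G\<close> killing makes Q f zero.\<close>

lemma subharmonic_le_survival:
  assumes inv: "invariant_set M K x0 G I" and G: "G \<in> sets M"
    and sub: "\<And>x. x \<in> I \<Longrightarrow> f x \<le> killed_op K G f x"
    and bound: "\<And>x. x \<in> I \<Longrightarrow> f x \<le> c"
    and "x \<in> I"
  shows "f x \<le> c * survival K G n x"
  using \<open>x \<in> I\<close>
proof (induction n arbitrary: x)
  case 0
  then show ?case by (simp add: survival_0 bound)
next
  case (Suc n)
  have x: "x \<in> space M"
    using Suc.prems inv sets.sets_into_space by (auto simp: invariant_set_def)
  show ?case
  proof (cases "x \<in> G")
    case True
    then show ?thesis using sub[OF Suc.prems] by (simp add: killed_op_goal)
  next
    case False
    have "f x \<le> (\<integral>\<^sup>+y. f y \<partial>K x)"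
      using sub[OF Suc.prems] False by (simp add: killed_op_off_goal)
    also have "\<dots> \<le> (\<integral>\<^sup>+y. c * survival K G n y \<partial>K x)"
      using AE_invariant[OF inv Suc.prems False] by (intro nn_integral_mono_AE) (auto intro: Suc.IH)
    also have "\<dots> = c * survival K G (Suc n) x"
      using False x G
      by (simp add: nn_integral_cmult borel_measurable_kernel survival_Suc killed_op_off_goal)
    finally show ?thesis .
  qed
qed

text \<open>From \<open>U x \<le> n * d r\<close>, a run of \<open>n\<close> decreases by
  \<open>d r\<close> leads into \<open>G\<close>, each having conditional probability at least
  \<open>\<epsilon> r\<close>. The run stays in the sublevel set of \<open>r\<close>, so the same
  constants apply throughout.\<close>

lemma variant_survival_bound:
  assumes inv: "invariant_set M K x0 G I" and G: "G \<in> sets M"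
    and U [measurable]: "U \<in> borel_measurable M" and U_nonneg: "\<And>x. x \<in> space M \<Longrightarrow> 0 \<le> U x"
    and var: "variant_criterion K G I V U H d \<epsilon>"
    and r: "0 \<le> r" "0 < d r" "0 < \<epsilon> r"
  shows "\<exists>N p. 0 < p \<and> p \<le> 1 \<and> (\<forall>x\<in>I. U x \<le> r \<longrightarrow> survival K G N x + ennreal p \<le> 1)"
proof -
  have I [measurable]: "I \<in> sets M" using inv by (simp add: invariant_set_def)
  \<comment> \<open>The cap at 1 keeps the powers of \<open>e\<close> at most 1, as needed when the
    run enters \<open>G\<close> early.\<close>
  define e where "e = min 1 (\<epsilon> r)"
  have e: "0 < e" "e \<le> 1" "e \<le> \<epsilon> r" using r by (auto simp: e_def)
  \<comment> \<open>The index is \<open>Suc n\<close> because a visit to \<open>G\<close> at time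
    \<open>n\<close> is detected only by the killing step that starts there.\<close>
  have bound: "survival K G (Suc n) x + ennreal (e ^ n) \<le> 1"
    if "x \<in> I" "U x \<le> r" "U x \<le> real n * d r" for x n
    using that
  proof (induction n arbitrary: x)
    case 0
    then have "x \<in> space M" using sets.sets_into_space[OF I] by auto
    with 0 have "U x = 0" using U_nonneg[of x] by simp
    then have "x \<in> G" using var r(1) 0 by (auto simp: variant_criterion_def)
    then show ?case by (simp add: survival_goal)
  next
    case (Suc n)
    have x: "x \<in> space M" using Suc.prems sets.sets_into_space[OF I] by auto
    show ?case
    proof (cases "x \<in> G")
      case True
      then show ?thesis using e by (simp add: survival_goal power_le_one del: power_Suc)
    next
      case False
      define A where "A = {y \<in> I. U y \<le> U x - d r}"
      have "A = I \<inter> {y \<in> space M. U y \<le> U x - d r}"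
        using sets.sets_into_space[OF I] by (auto simp: A_def)
      then have A: "A \<in> sets M" by simp
      interpret Kx: prob_space "K x" by (rule prob_space_kernel[OF x])
      have "e \<le> measure (K x) A"
        using var r(1) Suc.prems False e(3) by (force simp: variant_criterion_def A_def)
      then have "ennreal (e ^ Suc n) \<le> ennreal (e ^ n) * emeasure (K x) A"
        using e by (simp add: Kx.emeasure_eq_measure mult.commute mult_left_mono flip: ennreal_mult)
      then have "survival K G (Suc (Suc n)) x + ennreal (e ^ Suc n) \<le>
          (\<integral>\<^sup>+y. survival K G (Suc n) y \<partial>K x) + (\<integral>\<^sup>+y. ennreal (e ^ n) * indicator A y \<partial>K x)"
        using False A sets_kernel[OF x]
        by (subst nn_integral_cmult_indicator)
           (auto simp: survival_Suc[of K G "Suc n"] killed_op_off_goal intro!: add_left_mono)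
      also have "\<dots> = (\<integral>\<^sup>+y. survival K G (Suc n) y + ennreal (e ^ n) * indicator A y \<partial>K x)"
        using A G x
        by (intro nn_integral_add[symmetric] borel_measurable_kernel) auto
      \<comment> \<open>On \<open>A\<close> the variant has dropped by \<open>d r\<close>, so the
        induction hypothesis applies; off \<open>A\<close> survival is at most 1.\<close>
      also have "\<dots> \<le> (\<integral>\<^sup>+y. 1 \<partial>K x)"
      proof (intro nn_integral_mono)
        fix y assume "y \<in> space (K x)"
        then have y: "y \<in> space M" using space_kernel[OF x] by simp
        show "survival K G (Suc n) y + ennreal (e ^ n) * indicator A y \<le> 1"
        proof (cases "y \<in> A")
          case True
          then show ?thesis
            using Suc.IH[of y] Suc.prems r(2) by (auto simp: A_def algebra_simps)
        next
          case False
          then show ?thesis using survival_le_1[OF y] by simp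
        qed
      qed
      also have "\<dots> = 1" by (simp add: Kx.emeasure_space_1)
      finally show ?thesis .
    qed
  qed
  obtain n where "r / d r \<le> real n" using real_arch_simple by blast
  then have n: "r \<le> real n * d r" using r(2) by (simp add: divide_le_eq)
  show ?thesis
    using e bound[of _ n] n
    by (intro exI[of _ "Suc n"] exI[of _ "e ^ n"]) (auto simp: power_le_one)
qed

text \<open>Let c be the supremum of \<open>f\<close>. Where \<open>U \<le> r\<close>, the two
  preceding lemmas give f <= c s_N <= c (1 - p); elsewhere \<open>f\<close> is 0. Hence the supremum
  contracts.\<close>

lemma subharmonic_bounded_variant_zero:
  assumes inv: "invariant_set M K x0 G I" and G: "G \<in> sets M"
    and U: "U \<in> borel_measurable M" "\<And>x. x \<in> space M \<Longrightarrow> 0 \<le> U x"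
    and var: "variant_criterion K G I V U H d \<epsilon>"
    and r: "0 \<le> r" "0 < d r" "0 < \<epsilon> r"
    and sub: "\<And>x. x \<in> I \<Longrightarrow> f x \<le> killed_op K G f x"
    and bound: "\<And>x. x \<in> I \<Longrightarrow> f x \<le> 1"
    and zero: "\<And>x. x \<in> I \<Longrightarrow> r < U x \<Longrightarrow> f x = 0"
    and "x \<in> I"
  shows "f x = 0"
proof -
  define c where "c = (SUP x\<in>I. f x)"
  obtain N p where p: "0 < p" "p \<le> 1"
    and surv: "\<And>x. x \<in> I \<Longrightarrow> U x \<le> r \<Longrightarrow> survival K G N x + ennreal p \<le> 1"
    using variant_survival_bound[OF inv G U var r] by blast
  have "f y + c * ennreal p \<le> c" if y: "y \<in> I" for y
  proof (cases "U y \<le> r")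
    case True
    have "f y \<le> c * survival K G N y"
      using y unfolding c_def
      by (intro subharmonic_le_survival[where f = f, OF inv G sub]) (auto intro: SUP_upper)
    then have "f y + c * ennreal p \<le> c * (survival K G N y + ennreal p)"
      by (simp add: distrib_left add_right_mono)
    also have "\<dots> \<le> c * 1"
      by (intro mult_left_mono surv y True) simp
    finally show ?thesis by simp
  next
    case False
    then show ?thesis
      using zero[OF y] p mult_left_mono[of "ennreal p" 1 c] by simp
  qed
  then show ?thesis
    using bound p(1) \<open>x \<in> I\<close> unfolding c_def by (intro contraction_imp_zero)
qed

text \<open>The claim covers all of \<open>I\<close> because the contraction compares each point
  with the supremum over \<open>I\<close>.\<close>

lemma certificate_imp_escape_zero:
  assumes G: "G \<in> sets M" and cert: "reachability_certificate M K x0 G I T V U H d \<epsilon>"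
    and "x \<in> I"
  shows "escape K G x = 0"
proof -
  have inv: "invariant_set M K x0 G I" and GT: "G \<subseteq> T" and TI: "T \<subseteq> I"
    and V [measurable]: "V \<in> borel_measurable M" and V_nonneg: "\<And>x. x \<in> space M \<Longrightarrow> 0 \<le> V x"
    and U: "U \<in> borel_measurable M" "\<And>x. x \<in> space M \<Longrightarrow> 0 \<le> U x"
    and pos: "\<And>r. 0 \<le> r \<Longrightarrow> 0 < H r \<and> 0 < d r \<and> 0 < \<epsilon> r"
    and drift: "drift_criterion M K I T V" and var: "variant_criterion K G I V U H d \<epsilon>"
    using cert by (auto simp: reachability_certificate_def)
  have I: "I \<subseteq> space M"
    using inv sets.sets_into_space by (auto simp: invariant_set_def)
  note [measurable] = G
  define c where "c = (SUP x\<in>I. escape K G x)"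
  have "c \<le> 1" unfolding c_def using I by (intro SUP_least escape_le_1) auto
  then have c_fin: "c < \<infinity>" by (simp add: le_less_trans[OF _ ennreal_one_less_top])
  have harm: "escape K G x \<le> killed_op K G (escape K G) x" if "x \<in> I" for x
    using that I killed_op_escape[OF _ G] by auto
  have H0: "0 \<le> H 0" using pos[of 0] by simp
  obtain N p where p: "0 < p" "p \<le> 1"
    and surv: "\<And>x. x \<in> I \<Longrightarrow> U x \<le> H 0 \<Longrightarrow> survival K G N x + ennreal p \<le> 1"
    using variant_survival_bound[where r = "H 0", OF inv G U var H0] pos[OF H0] by blast
  have cp: "c * ennreal p \<le> c"
    using p mult_left_mono[of "ennreal p" 1 c] by simp
  \<comment> \<open>This is c (1 - p); \<open>cp\<close> shows that nothing is truncated, which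
    makes \<open>a_le\<close> an equivalence.\<close>
  define a where "a = c - c * ennreal p"
  have a_le: "b \<le> a \<longleftrightarrow> b + c * ennreal p \<le> c" for b
    unfolding a_def ennreal_le_minus_iff using cp by auto
  have on_T: "escape K G x \<le> a" if x: "x \<in> T" for x
  proof -
    have xI: "x \<in> I" using x TI by auto
    then have "V x = 0" using drift x I by (auto simp: drift_criterion_def)
    then have Ux: "U x \<le> H 0" using var xI by (auto simp: variant_criterion_def)
    have "escape K G x + c * ennreal p \<le> c * survival K G N x + c * ennreal p"
      using xI unfolding c_def
      by (intro add_right_mono subharmonic_le_survival[where f = "escape K G", OF inv G harm])
         (auto intro: SUP_upper)
    also have "\<dots> = c * (survival K G N x + ennreal p)"
      by (simp add: distrib_left)
    also have "\<dots> \<le> c * 1"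
      by (intro mult_left_mono surv xI Ux) simp
    finally show ?thesis by (simp add: a_le)
  qed
  have level: "escape K G x \<le> a + ennreal (V x / R)" if R: "0 < R" and x: "x \<in> I" for R x
  proof -
    \<comment> \<open>Truncated subtraction makes \<open>w\<close> the positive part of the excess
      of \<open>escape\<close> over the barrier a + V/R.\<close>
    define w where "w x = escape K G x - (a + ennreal (V x / R))" for x
    have [measurable]: "w \<in> borel_measurable M" unfolding w_def by measurable
    have w_zero: "w y = 0" if "y \<in> space M" "escape K G y \<le> a + ennreal (V y / R)" for y
      using that escape_le_1[of y G] le_less_trans[OF _ ennreal_one_less_top]
      by (auto simp: w_def diff_eq_0_iff_ennreal)
    have HR: "0 < H R" "0 < d (H R)" "0 < \<epsilon> (H R)"
      using pos[of R] pos[of "H R"] R by auto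
    have "w x = 0"
    proof (rule subharmonic_bounded_variant_zero[where r = "H R", OF inv G U var _ HR(2,3)])
      show "0 \<le> H R" using HR by simp
      show "x \<in> I" by fact
    next
      fix y assume y: "y \<in> I"
      have "w y \<le> escape K G y" unfolding w_def by (rule diff_le_self_ennreal)
      also have "\<dots> \<le> 1" using y I by (intro escape_le_1) auto
      finally show "w y \<le> 1" .
    next
      fix y assume y: "y \<in> I" and "H R < U y"
      then have ysp: "y \<in> space M" using I by auto
      \<comment> \<open>Contrapositive of the bound \<open>H R\<close> on \<open>U\<close> where
        \<open>V \<le> R\<close>. The term V/R alone then dominates the escape probability.\<close>
      have "R < V y" using \<open>H R < U y\<close> var R y by (auto simp: variant_criterion_def simp flip: not_le)
      then have "1 \<le> V y / R" using R by simp
      then have "1 \<le> ennreal (V y / R)" by simp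
      then have "escape K G y \<le> a + ennreal (V y / R)"
        using escape_le_1[of y G] y I by (meson add_increasing order_trans subsetD zero_le)
      then show "w y = 0" by (rule w_zero[OF ysp])
    next
      fix y assume y: "y \<in> I"
      then have ysp: "y \<in> space M" using I by auto
      show "w y \<le> killed_op K G w y"
      proof (cases "y \<in> T")
        \<comment> \<open>The drift condition says nothing on \<open>T\<close>; there
          \<open>on_T\<close> already makes \<open>w\<close> zero.\<close>
        case True
        then have "escape K G y \<le> a + ennreal (V y / R)"
          using on_T by (meson add_increasing2 zero_le)
        then have "w y = 0" by (rule w_zero[OF ysp])
        then show ?thesis by simp
      next
        case False
        then have yG: "y \<notin> G" using GT by auto
        have "(\<integral>\<^sup>+z. ennreal (V z) \<partial>K y) = (\<integral>\<^sup>+z\<in>I. ennreal (V z) \<partial>K y)"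
          using AE_invariant[OF inv y yG] by (intro nn_integral_cong_AE) auto
        also have "\<dots> \<le> ennreal (V y)"
          using drift y False by (auto simp: drift_criterion_def)
        finally have Vint: "(\<integral>\<^sup>+z. ennreal (V z) \<partial>K y) \<le> ennreal (V y)" .
        \<comment> \<open>Off \<open>T\<close>, \<open>escape\<close> is harmonic and the barrier
          superharmonic, so the excess is subharmonic; its positive part inherits this because the
          integral of \<open>w\<close> is nonnegative.\<close>
        have "escape K G y = (\<integral>\<^sup>+z. escape K G z \<partial>K y)"
          using killed_op_escape[OF ysp G] yG by (simp add: killed_op_off_goal)
        also have "\<dots> \<le> (\<integral>\<^sup>+z. w z + (a + ennreal (1 / R) * ennreal (V z)) \<partial>K y)"
        proof (intro nn_integral_mono)
          fix z assume "z \<in> space (K y)"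
          then have "0 \<le> V z" using space_kernel[OF ysp] V_nonneg by auto
          then have "ennreal (V z / R) = ennreal (1 / R) * ennreal (V z)"
            using R by (simp flip: ennreal_mult)
          then show "escape K G z \<le> w z + (a + ennreal (1 / R) * ennreal (V z))"
            unfolding w_def by (auto simp: diff_add_self_ennreal)
        qed
        also have "\<dots> = (\<integral>\<^sup>+z. w z \<partial>K y) + (a + ennreal (1 / R) * (\<integral>\<^sup>+z. ennreal (V z) \<partial>K y))"
          using ysp
          by (simp add: nn_integral_add nn_integral_cmult borel_measurable_kernel
              space_kernel emeasure_kernel_space)
        also have "\<dots> \<le> (\<integral>\<^sup>+z. w z \<partial>K y) + (a + ennreal (1 / R) * ennreal (V y))"
          by (intro add_left_mono mult_left_mono Vint) simp
        also have "ennreal (1 / R) * ennreal (V y) = ennreal (V y / R)"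
          using R V_nonneg[OF ysp] by (simp flip: ennreal_mult)
        finally have "escape K G y \<le> (a + ennreal (V y / R)) + (\<integral>\<^sup>+z. w z \<partial>K y)"
          by (simp add: ac_simps)
        then show ?thesis
          unfolding w_def[of y] killed_op_off_goal[OF yG]
          using escape_le_1[OF ysp, of G] by (auto simp: ennreal_minus_le_iff top_unique)
      qed
    qed
    then show ?thesis by (simp add: w_def diff_eq_0_iff_ennreal)
  qed
  have "escape K G x \<le> a" if x: "x \<in> I" for x
  proof (rule ennreal_le_epsilon)
    fix e :: real assume e: "0 < e"
    have Vx: "0 \<le> V x" using x I V_nonneg by auto
    \<comment> \<open>The choice \<open>R = (V x + 1) / e\<close> brings V/R below \<open>e\<close>;
      the summand 1 keeps \<open>R\<close> positive when \<open>V x = 0\<close>.\<close>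
    have "V x / ((V x + 1) / e) \<le> e"
      using Vx e by (simp add: field_simps)
    then show "escape K G x \<le> a + ennreal e"
      using level[of "(V x + 1) / e" x] x e Vx
      by (meson add_left_mono divide_pos_pos add_nonneg_pos ennreal_leI order_trans zero_less_one)
  qed
  then have "escape K G x + c * ennreal p \<le> c" if "x \<in> I" for x
    using that by (simp add: a_le)
  then show ?thesis
    using p(1) I \<open>x \<in> I\<close> unfolding c_def
    by (intro contraction_imp_zero[where I = I and p = p]) (auto intro: escape_le_1)
qed

subsection \<open>Completeness\<close>

text \<open>\<open>LEAST\<close> is informative only where some index qualifies. On the invariant
  set chosen below this is guaranteed by a survival probability of at most 1/2.\<close>

definition rank :: "'a set \<Rightarrow> 'a \<Rightarrow> nat" where
  "rank G x = (LEAST n. survival K G (Suc n) x \<le> ennreal (rank_level n))"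

lemma measurable_rank [measurable]:
  assumes [measurable]: "G \<in> sets M"
  shows "rank G \<in> M \<rightarrow>\<^sub>M count_space UNIV"
  unfolding rank_def[abs_def] by measurable

lemma rank_le: "survival K G (Suc n) x \<le> ennreal (1 / 2) \<Longrightarrow> rank G x \<le> n"
  unfolding rank_def
  by (rule Least_le) (auto simp: rank_level_def elim!: order_trans intro!: ennreal_leI)

lemma survival_rank:
  assumes "survival K G (Suc n) x \<le> ennreal (1 / 2)"
  shows "survival K G (Suc (rank G x)) x \<le> ennreal (rank_level (rank G x))"
  unfolding rank_def
  by (rule LeastI[of _ n])
     (use assms in \<open>auto simp: rank_level_def elim!: order_trans intro!: ennreal_leI\<close>)

text \<open>\<open>survival K G 1\<close> is 0 on \<open>G\<close> and 1 off it, and level 0 is 3/4,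
  strictly between.\<close>

lemma rank_eq_0_iff:
  assumes x: "x \<in> space M" and "survival K G (Suc n) x \<le> ennreal (1 / 2)"
  shows "rank G x = 0 \<longleftrightarrow> x \<in> G"
proof
  assume "rank G x = 0"
  then have "survival K G (Suc 0) x \<le> ennreal (3 / 4)"
    using survival_rank[OF assms(2)] by (simp add: rank_level_def power2_eq_square)
  moreover have "survival K G (Suc 0) x = 1" if "x \<notin> G"
    using that x by (simp add: survival_Suc killed_op_off_goal survival_0 space_kernel emeasure_kernel_space)
  ultimately show "x \<in> G" by (cases "x \<in> G") auto
next
  assume "x \<in> G"
  then show "rank G x = 0" using rank_le[of G 0 x] by (simp add: survival_goal)
qed

text \<open>
  If \<open>rank G x = Suc n\<close>, then \<open>survival K G (Suc n)\<close> has \<open>K x\<close>-mean at most \<open>rank_level (Suc n)\<close>, while it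
  exceeds \<open>rank_level n\<close> wherever the rank is not at most \<open>n\<close>; the gap between the two levels is the bound.
\<close>

lemma rank_decreases:
  assumes x: "x \<in> space M" and G [measurable]: "G \<in> sets M" and I [measurable]: "I \<in> sets M"
    and AE_I: "AE y in K x. y \<in> I"
    and rank: "rank G x = Suc n"
    and surv: "survival K G (Suc m) x \<le> ennreal (1 / 2)"
  shows "(1 / 2) ^ (n + 3) \<le> measure (K x) {y \<in> I. rank G y \<le> n}"
proof -
  interpret Kx: prob_space "K x" by (rule prob_space_kernel[OF x])
  define A where "A = {y \<in> space M. rank G y \<le> n}"
  have A [measurable]: "A \<in> sets M" unfolding A_def by measurable
  have xG: "x \<notin> G"
    using rank_eq_0_iff[OF x surv] rank by auto
  have "ennreal (rank_level n) = (\<integral>\<^sup>+y. ennreal (rank_level n) \<partial>K x)"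
    by (simp add: Kx.emeasure_space_1)
  also have "\<dots> \<le> (\<integral>\<^sup>+y. survival K G (Suc n) y + indicator A y \<partial>K x)"
  proof (intro nn_integral_mono)
    fix y assume "y \<in> space (K x)"
    then have y: "y \<in> space M" using space_kernel[OF x] by simp
    show "ennreal (rank_level n) \<le> survival K G (Suc n) y + indicator A y"
    proof (cases "y \<in> A")
      case True
      have "rank_level n \<le> 1"
        using power_le_one[of "1 / 2 :: real" "n + 2"] power_decreasing[of 1 "n + 2" "1 / 2 :: real"]
        by (simp add: rank_level_def)
      then have "ennreal (rank_level n) \<le> 1" by simp
      with True show ?thesis by (simp add: add_increasing)
    next
      case False
      then have "\<not> survival K G (Suc n) y \<le> ennreal (rank_level n)"
        unfolding A_def rank_def using y by (auto intro: Least_le)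
      with False show ?thesis by simp
    qed
  qed
  also have "\<dots> = survival K G (Suc (Suc n)) x + emeasure (K x) A"
    using xG x
    by (simp add: nn_integral_add borel_measurable_kernel sets_kernel survival_Suc[of K G "Suc n"]
        killed_op_off_goal)
  also have "\<dots> \<le> ennreal (rank_level (Suc n)) + ennreal (measure (K x) A)"
    using survival_rank[OF surv] unfolding rank
    by (intro add_mono) (simp_all add: Kx.emeasure_eq_measure)
  finally have "rank_level n \<le> rank_level (Suc n) + measure (K x) A"
    by (simp add: rank_level_def ennreal_le_iff flip: ennreal_plus)
  then have "(1 / 2) ^ (n + 3) \<le> measure (K x) A"
    by (simp add: rank_level_def power_add power3_eq_cube)
  \<comment> \<open>Restricting from \<open>space M\<close> to \<open>I\<close> loses no mass, by
    \<open>AE_I\<close>.\<close>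
  also have "measure (K x) A = measure (K x) {y \<in> I. rank G y \<le> n}"
  proof (rule Kx.finite_measure_eq_AE)
    show "AE y in K x. (y \<in> A) = (y \<in> {y \<in> I. rank G y \<le> n})"
      using AE_I by eventually_elim (use sets.sets_into_space[OF I] in \<open>auto simp: A_def\<close>)
    have "{y \<in> I. rank G y \<le> n} = I \<inter> A"
      using sets.sets_into_space[OF I] by (auto simp: A_def)
    then show "{y \<in> I. rank G y \<le> n} \<in> sets (K x)" by (simp add: sets_kernel[OF x])
  qed (simp add: sets_kernel[OF x])
  finally show ?thesis .
qed

lemma escape_zero_imp_certificate:
  assumes x0: "x0 \<in> space M" and G [measurable]: "G \<in> sets M" and esc: "escape K G x0 = 0"
  shows "\<exists>I T V U H d \<epsilon>. reachability_certificate M K x0 G I T V U H d \<epsilon>"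
proof -
  have "\<exists>n. survival K G (Suc n) x0 \<le> ennreal ((1 / 2) ^ k)" for k
  proof -
    have "(INF n. survival K G n x0) < ennreal ((1 / 2) ^ k)"
      using esc unfolding escape_def by simp
    then obtain n where "survival K G n x0 < ennreal ((1 / 2) ^ k)"
      by (auto simp: INF_less_iff)
    then show ?thesis
      using survival_Suc_le[OF x0, of G n] by (intro exI[of _ n]) auto
  qed
  then obtain m where m: "\<And>k. survival K G (Suc (m k)) x0 \<le> ennreal ((1 / 2) ^ k)"
    by metis
  \<comment> \<open>All indices are positive, so \<open>W\<close> vanishes on \<open>G\<close>; the
    first summand makes \<open>W\<close> at least 1 off \<open>G\<close>, and the geometric bounds
    make \<open>W x0\<close> finite.\<close>
  define W where "W x = survival K G 1 x + (\<Sum>k. survival K G (Suc (m k)) x)" for x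
  have W_meas [measurable]: "W \<in> borel_measurable M" unfolding W_def[abs_def] by measurable
  have W_goal: "W x = 0" if "x \<in> G" for x
    using that by (simp add: W_def survival_goal)
  have W_ge_1: "1 \<le> W x" if "x \<in> space M" "x \<notin> G" for x
    using that by (simp add: W_def survival_Suc survival_0 killed_op_off_goal space_kernel
        emeasure_kernel_space add_increasing2)
  \<comment> \<open>Integration against \<open>K x\<close> raises every index by one, and survival
    decreases in the index.\<close>
  have W_super: "(\<integral>\<^sup>+y. W y \<partial>K x) \<le> W x" if x: "x \<in> space M" and xG: "x \<notin> G" for x
  proof -
    have int: "(\<integral>\<^sup>+y. survival K G n y \<partial>K x) = survival K G (Suc n) x" for n
      using xG by (simp add: survival_Suc killed_op_off_goal)
    have "(\<integral>\<^sup>+y. W y \<partial>K x) = survival K G (Suc 1) x + (\<Sum>k. survival K G (Suc (Suc (m k))) x)"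
      unfolding W_def using x
      by (subst nn_integral_add)
         (auto simp: nn_integral_suminf borel_measurable_kernel int intro!: borel_measurable_kernel)
    also have "\<dots> \<le> W x"
      unfolding W_def
      by (intro add_mono suminf_le summableI allI survival_Suc_le x)
    finally show ?thesis .
  qed
  have "(\<Sum>k. survival K G (Suc (m k)) x0) \<le> (\<Sum>k. ennreal ((1 / 2) ^ k))"
    by (intro suminf_le summableI allI m)
  also have "\<dots> = ennreal (\<Sum>k. (1 / 2) ^ k)"
    by (intro suminf_ennreal2) (auto intro: summable_geometric)
  finally have W_x0: "W x0 < \<infinity>"
    using survival_le_1[OF x0, of G 1]
    by (auto simp: W_def le_less_trans[OF _ ennreal_less_top] le_less_trans[OF _ ennreal_one_less_top])
  define I where "I = {x \<in> space M. W x < \<infinity>}"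
  have I [measurable]: "I \<in> sets M" unfolding I_def by measurable
  have GI: "G \<subseteq> I" using sets.sets_into_space[OF G] by (auto simp: I_def W_goal)
  have AE_I: "AE y in K x. y \<in> I" if "x \<in> I" "x \<notin> G" for x
  proof -
    have x: "x \<in> space M" using that by (simp add: I_def)
    have "(\<integral>\<^sup>+y. W y \<partial>K x) \<noteq> \<infinity>"
      using W_super[OF x] that by (auto simp: I_def top_unique)
    then have "AE y in K x. W y \<noteq> \<infinity>"
      by (intro nn_integral_PInf_AE borel_measurable_kernel x W_meas)
    with AE_space show ?thesis
      by eventually_elim (simp add: I_def space_kernel[OF x] less_top)
  qed
  \<comment> \<open>The value 1 outside \<open>I\<close> is needed because
    \<open>drift_criterion\<close> asks for a nonzero value on all of \<open>space M\<close> off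
    \<open>T\<close>, whereas \<open>enn2real \<infinity> = 0\<close>.\<close>
  define V where "V x = (if x \<in> I then enn2real (W x) else 1)" for x
  have V_meas: "V \<in> borel_measurable M" unfolding V_def[abs_def] by measurable
  have V_W: "ennreal (V x) = W x" if "x \<in> I" for x
    using that by (simp add: V_def I_def)
  have V_nonneg: "0 \<le> V x" for x by (simp add: V_def)
  have V_zero: "V x = 0 \<longleftrightarrow> x \<in> G" if "x \<in> space M" for x
  proof (cases "x \<in> I")
    case True
    then have "V x = 0 \<longleftrightarrow> W x = 0"
      using V_W[OF True] V_nonneg[of x] by (metis ennreal_0 ennreal_eq_zero_iff)
    then show ?thesis using W_goal[of x] W_ge_1[OF that] by (cases "x \<in> G") auto
  next
    case False
    then show ?thesis using GI by (auto simp: V_def)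
  qed
  \<comment> \<open>\<open>L r\<close> exceeds \<open>2 * r\<close>, so \<open>L r\<close> summands
    above 1/2 would push \<open>W\<close> beyond \<open>r\<close>.\<close>
  define L where "L r = nat \<lceil>2 * r\<rceil> + 1" for r :: real
  have small: "\<exists>k<L r. survival K G (Suc (m k)) x \<le> ennreal (1 / 2)"
    if x: "x \<in> I" and r: "V x \<le> r" for x r
  proof (rule ccontr)
    assume "\<not> ?thesis"
    then have "(\<Sum>k<L r. ennreal (1 / 2)) \<le> (\<Sum>k<L r. survival K G (Suc (m k)) x)"
      by (intro sum_mono) (meson lessThan_iff linear)
    also have "\<dots> \<le> (\<Sum>k. survival K G (Suc (m k)) x)"
      by (intro sum_le_suminf summableI) auto
    also have "\<dots> \<le> W x" by (simp add: W_def add_increasing)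
    also have "\<dots> \<le> ennreal r" using V_W[OF x] r by (metis ennreal_leI)
    also have "(\<Sum>k<L r. ennreal (1 / 2)) = ennreal (real (L r) / 2)"
      by (subst sum_ennreal) auto
    finally have "ennreal (real (L r) / 2) \<le> ennreal r" .
    then have "real (L r) / 2 \<le> r"
      using order_trans[OF V_nonneg r] by (simp add: ennreal_le_iff)
    moreover have "2 * r < real (L r)" unfolding L_def by linarith
    ultimately show False by simp
  qed
  have V_small: "\<exists>n. survival K G (Suc n) x \<le> ennreal (1 / 2)" if "x \<in> I" for x
    using small[OF that order_refl] by blast
  define U where "U x = real (rank G x)" for x
  \<comment> \<open>The sum dominates each \<open>m k\<close> with \<open>k < L r\<close>, one of
    which bounds the rank when \<open>V x \<le> r\<close>; the 1 gives positivity.\<close>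
  define H where "H r = 1 + real (\<Sum>k<L r. m k)" for r
  \<comment> \<open>A rank \<open>Suc n \<le> r\<close> decreases with probability at least
    \<open>(1/2) ^ (n + 3)\<close>, and \<open>n + 3 \<le> r + 2\<close>. Since ranks are natural
    numbers, a constant decrease of 1 serves as \<open>d\<close>.\<close>
  define eps :: "real \<Rightarrow> real" where "eps r = (1 / 2) powr (r + 2)" for r
  have U_meas: "U \<in> borel_measurable M" unfolding U_def[abs_def] by measurable
  have inv: "invariant_set M K x0 G I"
    unfolding invariant_set_def
  proof (intro conjI ballI)
    show "x0 \<in> I" using x0 W_x0 by (simp add: I_def)
    fix x assume x: "x \<in> I - G"
    then have "x \<in> space M" by (simp add: I_def)
    then show "measure (K x) I = 1"
      using AE_I[of x] x prob_space.prob_eq_1[OF prob_space_kernel, of x I] by (simp add: sets_kernel)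
  qed (fact I GI)+
  have drift: "drift_criterion M K I G V"
    unfolding drift_criterion_def
  proof (intro conjI ballI)
    fix x assume "x \<in> space M"
    then show "V x = 0 \<longleftrightarrow> x \<in> G" by (rule V_zero)
  next
    fix x assume x: "x \<in> I - G"
    then have xs: "x \<in> space M" by (simp add: I_def)
    have "(\<integral>\<^sup>+y\<in>I. ennreal (V y) \<partial>K x) \<le> (\<integral>\<^sup>+y. W y \<partial>K x)"
      by (intro nn_integral_mono) (auto simp: V_W split: split_indicator)
    also have "\<dots> \<le> W x" using W_super[OF xs] x by simp
    finally show "(\<integral>\<^sup>+y\<in>I. ennreal (V y) \<partial>K x) \<le> ennreal (V x)" using V_W x by simp
  qed
  have var: "variant_criterion K G I V U H (\<lambda>_. 1) eps"
    unfolding variant_criterion_def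
  proof (intro allI impI ballI conjI)
    fix r x assume x: "x \<in> I" and "V x \<le> r"
    then obtain k where k: "k < L r" "survival K G (Suc (m k)) x \<le> ennreal (1 / 2)"
      using small by blast
    then have "rank G x \<le> m k" by (intro rank_le)
    also have "m k \<le> (\<Sum>k<L r. m k)" using k(1) by (intro member_le_sum) auto
    finally show "U x \<le> H r" by (simp add: U_def H_def del: of_nat_sum)
  next
    fix x assume x: "x \<in> I"
    then show "U x = 0 \<longleftrightarrow> x \<in> G"
      using V_small[OF x] rank_eq_0_iff[of x G] by (auto simp: U_def I_def)
  next
    fix r x assume x: "x \<in> I" and "x \<notin> G \<and> U x \<le> r"
    then have xG: "x \<notin> G" and Ur: "U x \<le> r" by auto
    have xs: "x \<in> space M" using x by (simp add: I_def)
    obtain k where k: "survival K G (Suc k) x \<le> ennreal (1 / 2)" using V_small[OF x] by blast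
    obtain n where n: "rank G x = Suc n"
      using rank_eq_0_iff[OF xs k] xG by (cases "rank G x") auto
    have "eps r \<le> (1 / 2) powr real (n + 3)"
      unfolding eps_def using Ur n by (intro powr_mono') (auto simp: U_def)
    also have "\<dots> = (1 / 2) ^ (n + 3)" by (rule powr_realpow) simp
    also have "\<dots> \<le> measure (K x) {y \<in> I. rank G y \<le> n}"
      by (rule rank_decreases[OF xs G I AE_I[OF x xG] n k])
    also have "{y \<in> I. rank G y \<le> n} = {y \<in> I. U y \<le> U x - 1}"
      by (simp add: U_def n)
    finally show "eps r \<le> measure (K x) {y \<in> I. U y \<le> U x - 1}" .
  qed
  have pos: "0 < H r" "0 < eps r" for r
    by (simp_all add: H_def eps_def add_pos_nonneg sum_nonneg)
  have "reachability_certificate M K x0 G I G V U H (\<lambda>_. 1) eps"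
    unfolding reachability_certificate_def
    using inv G GI V_meas V_nonneg U_meas pos drift var by (auto simp: U_def)
  then show ?thesis by blast
qed

end

theorem theorem1:
  fixes M :: "'a measure" and K :: "'a \<Rightarrow> 'a measure" and x0 :: 'a and Goal :: "'a set"
  assumes "markov_process M K"
    and "x0 \<in> space M"
    and "Goal \<in> sets M"
  shows "((\<exists>Inv T V U H d \<epsilon>. reachability_certificate M K x0 Goal Inv T V U H d \<epsilon>) \<longrightarrow>
           \<P>(\<omega> in trajectory_law M K x0. hitting_time Goal \<omega> < \<infinity>) = 1) \<and>
         (\<P>(\<omega> in trajectory_law M K x0. hitting_time Goal \<omega> < \<infinity>) = 1 \<longrightarrow>
           (\<exists>Inv T V U H d \<epsilon>. reachability_certificate M K x0 Goal Inv T V U H d \<epsilon>))"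
proof -
  interpret markov_process M K by fact
  have "escape K Goal x0 = 0" if "reachability_certificate M K x0 Goal Inv T V U H d \<epsilon>"
    for Inv T V U H d \<epsilon>
    using certificate_imp_escape_zero[OF assms(3) that] that
    by (simp add: reachability_certificate_def invariant_set_def)
  then show ?thesis
    unfolding almost_surely_hits_iff[OF assms(2,3)]
    using escape_zero_imp_certificate[OF assms(2,3)] by blast
qed

end
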